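(* Fix an adjacency type $t\in\{1,2,3,4\}$ and integers $1\le k\le n$. For every two irreducible (with respect to type $t$) permutations $\sigma,\tau$ of $\{0,1,\dots,k-1\}$, the number of permutations of $\{0,1,\dots,n-1\}$ whose reduced form (with respect to type $t$) equals $\sigma$ is the same as the number of permutations of $\{0,1,\dots,n-1\}$ whose reduced form equals $\tau$. That is, if some $\sigma\in P_k(0)$ is the reduced form of exactly $\mu$ permutations in $P_n$, then every $\sigma'\in P_k(0)$ is the reduced form of exactly $\mu$ permutations in $P_n$.
   Context: $P_m$ denotes the set of permutations of $\{0,1,\dots,m-1\}$, written as sequences $\pi=(\pi_1,\dots,\pi_m)$. Adjacency types: a type 1 adjacency is an index $i\in\{1,\dots,m-1\}$ with $\pi_{i+1}=\pi_i+1$. Type 2 adjacencies are the type 1 adjacencies plus one more if $\pi_m=m-1$. Type 3 adjacencies are the type 1 adjacencies plus one more if $\pi_1=0$. Type 4 adjacencies are the type 1 adjacencies plus one more if $\pi_m=m-1$ and one more if $\pi_1=0$. $P_m(j)$ is the set of permutations in $P_m$ with exactly $j$ adjacencies of the fixed type; a permutation is irreducible if it has no adjacencies, so $P_k(0)$ is the set of irreducible permutations of $\{0,\dots,k-1\}$. The reduced form of $\pi$ is obtained by repeating the following while an adjacency of the fixed type exists: if $\pi_{i+1}=\pi_i+1$ delete the entry $\pi_{i+1}$; (types 2, 4) if the last entry equals $m-1$, where $m$ is the current length, delete it; (types 3, 4) if the first entry is $0$, delete it; after each deletion, relabel the remaining entries by the unique order-preserving bijection onto $\{0,\dots,m-2\}$.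 Each deletion removes exactly one adjacency, the result is irreducible and does not depend on the order of deletions; a permutation in $P_n(n-k)$ has a reduced form in $P_k(0)$. *)

theory Defs
  imports "HOL-Combinatorics.Multiset_Permutations"
begin

text \<open>
  A permutation \<open>(\<pi>\<^sub>1, \<dots>, \<pi>\<^sub>m)\<close> of \<open>{0, \<dots>, m - 1}\<close> is a list in \<^term>\<open>permutations_of_set {0..<m}\<close>.
  List positions count from 0, so the entry \<open>\<pi>\<^sub>i\<close> is \<open>\<pi> ! (i - 1)\<close>.
\<close>

datatype adj_type = Type1 | Type2 | Type3 | Type4

definition inner_adj :: "nat list \<Rightarrow> nat \<Rightarrow> bool" where
  "inner_adj \<pi> i \<longleftrightarrow> Suc i < length \<pi> \<and> \<pi> ! Suc i = \<pi> ! i + 1"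

definition last_adj :: "adj_type \<Rightarrow> nat list \<Rightarrow> bool" where
  "last_adj t \<pi> \<longleftrightarrow> t \<in> {Type2, Type4} \<and> \<pi> \<noteq> [] \<and> last \<pi> = length \<pi> - 1"

definition first_adj :: "adj_type \<Rightarrow> nat list \<Rightarrow> bool" where
  "first_adj t \<pi> \<longleftrightarrow> t \<in> {Type3, Type4} \<and> \<pi> \<noteq> [] \<and> hd \<pi> = 0"

definition num_adj :: "adj_type \<Rightarrow> nat list \<Rightarrow> nat" where
  "num_adj t \<pi> =
     card {i. inner_adj \<pi> i} + (if last_adj t \<pi> then 1 else 0) + (if first_adj t \<pi> then 1 else 0)"

definition perms_with_adj :: "adj_type \<Rightarrow> nat \<Rightarrow> nat \<Rightarrow> nat list set" where
  "perms_with_adj t m j = {\<pi> \<in> permutations_of_set {0..<m}. num_adj t \<pi> = j}"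

text \<open>
  For a list of distinct entries, sending each entry to its rank is the unique order-preserving
  bijection from the set of entries onto an initial segment of the natural numbers.
\<close>

definition relabel :: "nat list \<Rightarrow> nat list" where
  "relabel xs = map (\<lambda>x. card {y \<in> set xs. y < x}) xs"

inductive reduction_step :: "adj_type \<Rightarrow> nat list \<Rightarrow> nat list \<Rightarrow> bool" for t where
  inner: "inner_adj \<pi> i \<Longrightarrow> reduction_step t \<pi> (relabel (take (Suc i) \<pi> @ drop (Suc (Suc i)) \<pi>))"
| last: "last_adj t \<pi> \<Longrightarrow> reduction_step t \<pi> (relabel (butlast \<pi>))"
| first: "first_adj t \<pi> \<Longrightarrow> reduction_step t \<pi> (relabel (tl \<pi>))"

text \<open>
  Reduction may choose any available adjacency at each step, so the outcome is specified as a
  relation: \<open>\<sigma>\<close> is reachable from \<open>\<pi>\<close> and has no adjacency left. On permutations the outcome does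
  not depend on the choices made.
\<close>

definition is_reduced_form :: "adj_type \<Rightarrow> nat list \<Rightarrow> nat list \<Rightarrow> bool" where
  "is_reduced_form t \<pi> \<sigma> \<longleftrightarrow> (reduction_step t)\<^sup>*\<^sup>* \<pi> \<sigma> \<and> num_adj t \<sigma> = 0"

end

theory Submission
  imports Defs
begin

text \<open>
  Undoing a reduction step inserts one value into a permutation. Several insertions together
  replace each entry \<open>v\<close> of \<open>\<sigma>\<close> by an interval \<open>S v, \<dots>, S (v + 1) - 1\<close>, preceded by an initial
  and followed by a final interval (for the types that allow them), where \<open>S\<close> is strictly increasing.
  Hence the permutations that reduce to \<open>\<sigma>\<close> are exactly the inflations of \<open>\<sigma>\<close>. The range of
  \<open>S\<close> does not depend on \<open>\<sigma>\<close>, and an irreducible \<open>\<sigma>\<close> lets one recover \<open>S\<close> from the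
  inflation, since no two neighbouring intervals merge. Confluence of the reduction is not needed.
\<close>

section \<open>Inflations and their composition\<close>

definition blow_up :: "(nat \<Rightarrow> nat) \<Rightarrow> nat list \<Rightarrow> nat list" where
  "blow_up S xs = concat (map (\<lambda>v. [S v..<S (Suc v)]) xs)"

definition inflate :: "nat \<Rightarrow> (nat \<Rightarrow> nat) \<Rightarrow> nat list \<Rightarrow> nat list" where
  "inflate n S xs = [0..<S 0] @ blow_up S xs @ [S (length xs)..<n]"

text \<open>
  Only the values \<open>S 0, \<dots>, S k\<close> matter. Those beyond \<open>k\<close> are fixed so that \<open>S\<close> is determined by
  its inflation, and in such a way that cuts are closed under composition.
\<close>

definition cuts :: "adj_type \<Rightarrow> nat \<Rightarrow> nat \<Rightarrow> (nat \<Rightarrow> nat) set" where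
  "cuts t k n = {S. strict_mono S \<and> S k \<le> n \<and> (\<forall>i>k. S i = n + (i - k)) \<and>
     (t \<in> {Type1, Type2} \<longrightarrow> S 0 = 0) \<and> (t \<in> {Type1, Type3} \<longrightarrow> S k = n)}"

text \<open>
  Inflating by \<open>gap i\<close> undoes a single reduction step: a first step for \<open>i = 0\<close>, a last step for
  \<open>i = m + 1\<close> with \<open>m\<close> the length, and otherwise an inner step that deleted the value \<open>i\<close>.
\<close>

definition gap :: "nat \<Rightarrow> nat \<Rightarrow> nat" where
  "gap i x = (if x < i then x else Suc x)"

lemma blow_up_simps [simp]:
  "blow_up S [] = []"
  "blow_up S (x # xs) = [S x..<S (Suc x)] @ blow_up S xs"
  "blow_up S (xs @ ys) = blow_up S xs @ blow_up S ys"
  by (simp_all add: blow_up_def)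

lemma upt_append_upt: "i \<le> j \<Longrightarrow> j \<le> k \<Longrightarrow> [i..<j] @ [j..<k] = [i..<k]"
  by (metis le_add_diff_inverse upt_add_eq_append)

text \<open>The intervals of consecutive entries telescope, each beginning where the previous one
  ends.\<close>

lemma blow_up_upt:
  assumes "mono g" "p \<le> q"
  shows "blow_up g [p..<q] = [g p..<g q]"
  using assms(2)
proof (induction q rule: dec_induct)
  case (step q)
  then show ?case
    using assms(1) by (simp add: upt_append_upt monoD)
qed simp

lemma blow_up_blow_up:
  assumes "mono f" "mono g"
  shows "blow_up g (blow_up f xs) = blow_up (g \<circ> f) xs"
proof (induction xs)
  case (Cons x xs)
  have "f x \<le> f (Suc x)"
    using assms(1) by (simp add: monoD)
  with Cons show ?case
    using assms(2) by (simp add: blow_up_upt)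
qed simp

lemma cuts_mono: "S \<in> cuts t k n \<Longrightarrow> mono S"
  by (simp add: cuts_def strict_mono_mono)

text \<open>The outer initial interval fuses with the blow-up of the inner one into
  \<open>[0..<g (f 0)]\<close>, and the final intervals fuse likewise: the length hypothesis makes
  the outer one start at \<open>g n\<close>, where the blow-up of the inner one stops.\<close>

lemma inflate_inflate:
  assumes "f \<in> cuts t k n" "g \<in> cuts t n n'" "length xs = k" "length (inflate n f xs) = n"
  shows "inflate n' g (inflate n f xs) = inflate n' (g \<circ> f) xs"
proof -
  have m: "mono f" "mono g"
    using assms by (auto intro: cuts_mono)
  have "f k \<le> n" "g n \<le> n'"
    using assms by (auto simp: cuts_def)
  moreover have "g (f k) \<le> g n" "g 0 \<le> g (f 0)"
    using m \<open>f k \<le> n\<close> by (auto simp: monoD)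
  ultimately show ?thesis
    unfolding inflate_def[of n'] assms(4)
    by (simp add: inflate_def blow_up_blow_up m blow_up_upt assms upt_append_upt)
qed

section \<open>Composing cuts and splitting off single gaps\<close>

lemma cuts_comp:
  assumes "f \<in> cuts t k n" "g \<in> cuts t n n'"
  shows "g \<circ> f \<in> cuts t k n'"
proof -
  have "g (f k) \<le> g n"
    using assms by (auto simp: cuts_def intro: cuts_mono[OF assms(2), THEN monoD])
  with assms show ?thesis
    by (auto simp: cuts_def strict_mono_def)
qed

lemma gap_in_cuts:
  assumes "i \<le> Suc m" "t \<in> {Type1, Type2} \<Longrightarrow> 0 < i" "t \<in> {Type1, Type3} \<Longrightarrow> i \<le> m"
  shows "gap i \<in> cuts t m (Suc m)"
  using assms by (auto simp: cuts_def gap_def strict_mono_def)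

text \<open>As \<open>k \<le> n\<close>, the range of \<open>f\<close> misses some number. The outer
  factor is \<open>gap\<close> at the least missed number, which is also the least point moved by
  \<open>f\<close>; lowering the larger values of \<open>f\<close> by one gives the inner
  factor.\<close>

lemma cuts_factor:
  assumes "f \<in> cuts t k (Suc n)" "k \<le> n"
  obtains i f' where "f' \<in> cuts t k n" "gap i \<in> cuts t n (Suc n)" "f = gap i \<circ> f'"
proof -
  have f: "strict_mono f" "f k \<le> Suc n" "\<And>i. i > k \<Longrightarrow> f i = Suc n + (i - k)"
    "t \<in> {Type1, Type2} \<Longrightarrow> f 0 = 0" "t \<in> {Type1, Type3} \<Longrightarrow> f k = Suc n"
    using assms(1) by (auto simp: cuts_def)
  define j where "j = (LEAST j. f j \<noteq> j)"
  \<comment> \<open>The prescribed value \<open>Suc n + 1\<close> at \<open>Suc k\<close> supplies a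
    moved point, so that \<open>j\<close> exists and is at most \<open>Suc k\<close>.\<close>
  have ex: "f (Suc k) \<noteq> Suc k"
    using f(3)[of "Suc k"] assms(2) by simp
  have j: "f j \<noteq> j" "j \<le> Suc k"
    unfolding j_def using ex by (rule LeastI, rule Least_le)
  have below: "f x = x" if "x < j" for x
    using that not_less_Least unfolding j_def by blast
  have above: "Suc x \<le> f x" if "j \<le> x" for x
    using that
  proof (induction x rule: dec_induct)
    case base
    show ?case
      using j(1) strict_mono_imp_increasing[OF f(1), of j] by linarith
  next
    case (step x)
    then show ?case
      using strict_monoD[OF f(1), of x "Suc x"] by simp
  qed
  define f' where "f' x = (if x < j then x else f x - 1)" for x
  have "f = gap j \<circ> f'"
  proof
    fix x show "f x = (gap j \<circ> f') x"
      using below[of x] above[of x] by (auto simp: f'_def gap_def)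
  qed
  moreover have "strict_mono f'"
  proof (rule strict_monoI)
    fix x y :: nat assume "x < y"
    then show "f' x < f' y"
      using strict_monoD[OF f(1) \<open>x < y\<close>] above[of x] above[of y] by (auto simp: f'_def)
  qed
  then have "f' \<in> cuts t k n"
    using f j below[of k] below[of 0] assms(2) by (force simp: cuts_def f'_def)
  moreover have "gap j \<in> cuts t n (Suc n)"
  proof (rule gap_in_cuts)
    show "j \<le> Suc n"
      using j(2) assms(2) by simp
    show "0 < j" if "t \<in> {Type1, Type2}"
      using f(4)[OF that] j(1) by (cases j) auto
    show "j \<le> n" if "t \<in> {Type1, Type3}"
      using f(5)[OF that] below[of k] assms(2) by (cases "k < j") auto
  qed
  ultimately show thesis
    by (rule that[rotated 2])
qed

text \<open>Strict monotonicity gives \<open>i \<le> f i\<close>; descending from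
  \<open>f k \<le> k\<close> gives the reverse bound.\<close>

lemma cuts_refl:
  assumes "f \<in> cuts t k k"
  shows "f = (\<lambda>i. i)"
proof
  fix i
  have f: "strict_mono f" "f k \<le> k" "\<And>i. i > k \<Longrightarrow> f i = k + (i - k)"
    using assms by (auto simp: cuts_def)
  have "f (k - d) \<le> k - d" if "d \<le> k" for d
    using that
  proof (induction d)
    case (Suc d)
    then show ?case
      using strict_monoD[OF f(1), of "k - Suc d" "k - d"] by linarith
  qed (use f(2) in simp)
  from this[of "k - i"] have "f i \<le> i"
    using f(3)[of i] by (cases "i \<le> k") auto
  then show "f i = i"
    using strict_mono_imp_increasing[OF f(1), of i] by simp
qed

lemma id_in_cuts: "(\<lambda>i. i) \<in> cuts t k k"
  by (auto simp: cuts_def strict_mono_def)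

lemma inflate_id: "length xs = k \<Longrightarrow> inflate k (\<lambda>i. i) xs = xs"
  by (induction xs arbitrary: k) (auto simp: inflate_def)

section \<open>One insertion against one reduction step\<close>

lemma length_permutation: "\<pi> \<in> permutations_of_set {0..<m} \<Longrightarrow> length \<pi> = m"
  by (simp add: length_finite_permutations_of_set)

text \<open>The values below \<open>g x\<close> are the \<open>g y\<close> with
  \<open>y < x\<close>, so the rank of \<open>g x\<close> is \<open>x\<close>. This identifies the
  relabelled result of a deletion.\<close>

lemma relabel_map_strict_mono:
  assumes "strict_mono g" "set xs = {0..<m}"
  shows "relabel (map g xs) = xs"
proof -
  have "card {y \<in> set (map g xs). y < g x} = x" if "x \<in> set xs" for x
  proof -
    have "{y \<in> set (map g xs). y < g x} = g ` {0..<x}"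
      using that assms by (auto simp: strict_mono_less)
    then show ?thesis
      using assms(1) by (simp add: card_image strict_mono_imp_inj_on inj_on_subset)
  qed
  then show ?thesis
    by (simp add: relabel_def map_idI)
qed

lemma strict_mono_gap: "strict_mono (gap i)"
  by (auto simp: gap_def strict_mono_def)

text \<open>Under \<open>gap i\<close> only an entry \<open>v\<close> with \<open>Suc v = i\<close>
  gets an interval of length two; all others get singletons.\<close>

lemma blow_up_gap:
  assumes "i \<notin> Suc ` set xs"
  shows "blow_up (gap i) xs = map (gap i) xs"
  using assms by (induction xs) (auto simp: gap_def)

lemma inflate_gap_0: "inflate (Suc (length xs)) (gap 0) xs = 0 # map Suc xs"
  by (simp add: inflate_def blow_up_gap gap_def)

lemma inflate_gap_last:
  assumes "\<pi> \<in> permutations_of_set {0..<m}"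
  shows "inflate (Suc m) (gap (Suc m)) \<pi> = \<pi> @ [m]"
proof -
  have "Suc m \<notin> Suc ` set \<pi>" "length \<pi> = m" "set \<pi> = {0..<m}"
    using assms length_permutation by (auto dest: permutations_of_setD)
  moreover from this have "map (gap (Suc m)) \<pi> = \<pi>"
    by (intro map_idI) (auto simp: gap_def)
  ultimately show ?thesis
    by (simp add: inflate_def blow_up_gap) (simp add: gap_def)
qed

lemma inflate_gap_inner:
  assumes "xs @ a # ys \<in> permutations_of_set {0..<m}"
  shows "inflate (Suc m) (gap (Suc a)) (xs @ a # ys)
    = map (gap (Suc a)) xs @ a # Suc a # map (gap (Suc a)) ys"
proof -
  have "a < m" "Suc a \<notin> Suc ` set xs" "Suc a \<notin> Suc ` set ys" "Suc (length xs + length ys) = m"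
    using permutations_of_setD[OF assms] length_permutation[OF assms] by auto
  then show ?thesis
    by (auto simp: inflate_def blow_up_gap gap_def)
qed

lemma gap_image: "i \<le> m \<Longrightarrow> gap i ` {0..<m} = {0..<Suc m} - {i}"
proof
  show "{0..<Suc m} - {i} \<subseteq> gap i ` {0..<m}" if "i \<le> m"
  proof
    fix x assume x: "x \<in> {0..<Suc m} - {i}"
    show "x \<in> gap i ` {0..<m}"
      by (rule image_eqI[of _ _ "if x < i then x else x - 1"]) (use x that in \<open>auto simp: gap_def\<close>)
  qed
qed (auto simp: gap_def)

text \<open>The inserted value creates an adjacency at the start, at the end or inside. Deleting it
  leaves a strictly monotone image of \<open>\<pi>\<close>, which \<open>relabel\<close> turns back
  into \<open>\<pi>\<close>.\<close>

lemma inflate_gap_reduces: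
  assumes "\<pi> \<in> permutations_of_set {0..<m}" "gap i \<in> cuts t m (Suc m)"
  defines "\<rho> \<equiv> inflate (Suc m) (gap i) \<pi>"
  shows "\<rho> \<in> permutations_of_set {0..<Suc m}" "reduction_step t \<rho> \<pi>"
proof -
  note \<pi> = permutations_of_setD[OF assms(1)] length_permutation[OF assms(1)]
  have i: "i \<le> Suc m" "t \<in> {Type1, Type2} \<Longrightarrow> 0 < i" "t \<in> {Type1, Type3} \<Longrightarrow> i \<le> m"
  proof -
    \<comment> \<open>The prescribed value beyond \<open>m\<close> bounds \<open>i\<close>: for a
      larger \<open>i\<close>, \<open>gap i\<close> would fix \<open>Suc m\<close>.\<close>
    have "gap i (Suc m) = Suc m + 1"
      using assms(2) by (auto simp: cuts_def)
    then show "i \<le> Suc m" by (auto simp: gap_def split: if_splits)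
  qed (use assms(2) in \<open>auto simp: cuts_def gap_def split: if_splits\<close>)
  consider "i = 0" | "i = Suc m" | a where "i = Suc a" "a < m"
    using i(1) by (cases i) (auto simp: le_less)
  then have "\<rho> \<in> permutations_of_set {0..<Suc m} \<and> reduction_step t \<rho> \<pi>"
  proof cases
    case 1
    have \<rho>: "\<rho> = 0 # map Suc \<pi>"
      using inflate_gap_0[of \<pi>] \<pi> 1 by (simp add: \<rho>_def)
    have "t \<in> {Type3, Type4}"
      using i(2) 1 by (cases t) auto
    then have "first_adj t \<rho>"
      by (simp add: first_adj_def \<rho>)
    from reduction_step.first[OF this] show ?thesis
      using relabel_map_strict_mono[OF _ \<pi>(1), of Suc] \<pi>
      by (auto simp: \<rho> strict_mono_def permutations_of_set_def distinct_map lessThan_Suc_eq_insert_0 atLeast0LessThan)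
  next
    case 2
    have \<rho>: "\<rho> = \<pi> @ [m]"
      using inflate_gap_last[OF assms(1)] 2 by (simp add: \<rho>_def)
    have "t \<in> {Type2, Type4}"
      using i(3) 2 by (cases t) auto
    then have "last_adj t \<rho>"
      using \<pi> by (simp add: last_adj_def \<rho>)
    from reduction_step.last[OF this] show ?thesis
      using relabel_map_strict_mono[OF _ \<pi>(1), of "\<lambda>x. x"] \<pi>
      by (auto simp: \<rho> strict_mono_def permutations_of_set_def)
  next
    case 3
    then obtain xs ys where split: "\<pi> = xs @ a # ys"
      using \<pi>(1) by (metis atLeastLessThan_iff le0 split_list)
    let ?g = "gap (Suc a)"
    have \<rho>: "\<rho> = map ?g xs @ a # Suc a # map ?g ys"
      using inflate_gap_inner[of xs a ys m] assms(1) 3 by (simp add: \<rho>_def split)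
    have eq: "map ?g xs @ a # map ?g ys = map ?g \<pi>"
      by (simp add: split gap_def)
    have "set (map ?g \<pi>) = {0..<Suc m} - {Suc a}"
      using gap_image[of "Suc a" m] 3 \<pi>(1) by simp
    then have s: "set \<rho> = {0..<Suc m}"
      using 3 unfolding \<rho> eq[symmetric] by auto
    have "length \<rho> = Suc m"
      using \<pi> by (simp add: \<rho> split)
    with s have "\<rho> \<in> permutations_of_set {0..<Suc m}"
      by (intro permutations_of_setI card_distinct) simp_all
    moreover have "inner_adj \<rho> (length xs)"
      by (simp add: inner_adj_def \<rho> nth_append)
    from reduction_step.inner[OF this, of t] have "reduction_step t \<rho> \<pi>"
      using relabel_map_strict_mono[OF strict_mono_gap \<pi>(1), of "Suc a"]
      by (simp add: \<rho> eq)
    ultimately show ?thesis ..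
  qed
  then show "\<rho> \<in> permutations_of_set {0..<Suc m}" "reduction_step t \<rho> \<pi>"
    by auto
qed

lemma map_gap_exists:
  assumes "distinct xs" "set xs = {0..<Suc m} - {i}" "i \<le> m"
  obtains zs where "zs \<in> permutations_of_set {0..<m}" "xs = map (gap i) zs"
proof -
  have inj: "inj (gap i)"
    by (simp add: strict_mono_gap strict_mono_imp_inj_on)
  have "set xs \<subseteq> range (gap i)"
    using gap_image[OF assms(3)] assms(2) by blast
  then obtain zs where zs: "xs = map (gap i) zs"
    by (metis ex_map_conv image_iff subset_iff)
  then have "gap i ` set zs = gap i ` {0..<m}"
    using gap_image[OF assms(3)] assms(2) by simp
  then have "set zs = {0..<m}"
    using inj by (simp add: inj_image_eq_iff)
  moreover have "distinct zs"
    using assms(1) zs by (simp add: distinct_map)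
  ultimately show thesis
    using zs by (intro that permutations_of_setI)
qed

text \<open>Converse of \<open>inflate_gap_reduces\<close>. For an inner, last or first step the cut
  is \<open>gap (Suc a)\<close>, \<open>gap (Suc m)\<close> or \<open>gap 0\<close>, where
  \<open>a\<close> is the entry before the deleted one.\<close>

lemma reduction_step_inflate:
  assumes "reduction_step t \<rho> \<pi>" "\<rho> \<in> permutations_of_set {0..<n}"
  obtains m g where "n = Suc m" "\<pi> \<in> permutations_of_set {0..<m}" "g \<in> cuts t m n"
    "\<rho> = inflate n g \<pi>"
proof -
  note \<rho> = permutations_of_setD[OF assms(2)] length_permutation[OF assms(2)]
  from assms(1) show thesis
  proof cases
    case (inner j)
    let ?xs = "take j \<rho>" and ?a = "\<rho> ! j" and ?ys = "drop (Suc (Suc j)) \<rho>"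
    have split: "\<rho> = ?xs @ ?a # Suc ?a # ?ys"
      using inner(2) id_take_nth_drop[of j \<rho>] Cons_nth_drop_Suc[of "Suc j" \<rho>]
      by (simp add: inner_adj_def)
    have take: "take (Suc j) \<rho> @ ?ys = ?xs @ ?a # ?ys"
      using inner(2) by (simp add: inner_adj_def take_Suc_conv_app_nth)
    define xs a ys where "xs = ?xs" and "a = ?a" and "ys = ?ys"
    note split = split[folded xs_def a_def ys_def] and take = take[folded xs_def a_def ys_def]
    have "Suc a \<in> set \<rho>"
      by (subst split) simp
    then obtain m where m: "n = Suc m" "a < m"
      using \<rho>(1) by (cases n) auto
    have d: "distinct (xs @ a # ys)" "Suc a \<notin> set (xs @ a # ys)"
      using \<rho>(2) by (subst (asm) split, simp)+
    moreover have "insert (Suc a) (set (xs @ a # ys)) = {0..<Suc m}"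
      using \<rho>(1) m(1) by (subst (asm) split) auto
    then have s: "set (xs @ a # ys) = {0..<Suc m} - {Suc a}"
      using d by blast
    from map_gap_exists[OF d(1) s] m(2) obtain zs where
      zs: "zs \<in> permutations_of_set {0..<m}" "xs @ a # ys = map (gap (Suc a)) zs"
      by auto
    then obtain us v vs where uv: "zs = us @ v # vs" "xs = map (gap (Suc a)) us"
        "a = gap (Suc a) v" "ys = map (gap (Suc a)) vs"
      by (auto simp: append_eq_map_conv Cons_eq_map_conv)
    have v: "v = a"
      using uv(3) by (auto simp: gap_def split: if_splits)
    have "\<pi> = zs"
      using inner(1) zs permutations_of_setD(1)[OF zs(1)]
      by (simp add: take ys_def[symmetric] relabel_map_strict_mono[OF strict_mono_gap])
    moreover have "\<rho> = inflate n (gap (Suc a)) zs"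
      using inflate_gap_inner[of us a vs m] zs(1) uv(1) v m split uv(2,4) by simp
    moreover have "gap (Suc a) \<in> cuts t m n"
      using m by (auto intro: gap_in_cuts)
    ultimately show thesis
      using that m(1) zs(1) by blast
  next
    case last
    obtain m where m: "n = Suc m"
      using last(2) \<rho> by (cases n) (auto simp: last_adj_def)
    have t: "t \<in> {Type2, Type4}" and split: "\<rho> = butlast \<rho> @ [m]"
      using last(2) \<rho>(3) m append_butlast_last_id[of \<rho>] by (auto simp: last_adj_def)
    have "distinct (butlast \<rho> @ [m])" "set (butlast \<rho> @ [m]) = {0..<Suc m}"
      using \<rho> m split by simp_all
    then have "distinct (butlast \<rho>)" "set (butlast \<rho>) = {0..<m}"
      by (simp_all add: atLeast0_lessThan_Suc insert_ident)
    then have zs: "butlast \<rho> \<in> permutations_of_set {0..<m}"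
      by (rule permutations_of_setI[rotated])
    have "\<pi> = butlast \<rho>"
      using last(1) relabel_map_strict_mono[of "\<lambda>x. x" "butlast \<rho>" m] permutations_of_setD(1)[OF zs]
      by (simp add: strict_mono_def)
    moreover have "\<rho> = inflate n (gap (Suc m)) (butlast \<rho>)"
      using inflate_gap_last[OF zs] split m by simp
    moreover have "gap (Suc m) \<in> cuts t m n"
      using t m by (auto intro: gap_in_cuts)
    ultimately show thesis
      using that m zs by metis
  next
    case first
    obtain m where m: "n = Suc m"
      using first(2) \<rho> by (cases n) (auto simp: first_adj_def)
    have t: "t \<in> {Type3, Type4}" and split: "\<rho> = 0 # tl \<rho>"
      using first(2) by (auto simp: first_adj_def neq_Nil_conv)
    have "distinct (0 # tl \<rho>)" "set (0 # tl \<rho>) = {0..<Suc m}"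
      using \<rho> m split by simp_all
    then have d: "distinct (tl \<rho>)" "set (tl \<rho>) = {0..<Suc m} - {0}"
      by (auto simp del: atLeastLessThan_iff)
    obtain zs where zs: "zs \<in> permutations_of_set {0..<m}" "tl \<rho> = map (gap 0) zs"
      using map_gap_exists[OF d] by auto
    have "\<pi> = zs"
      using first(1) zs permutations_of_setD(1)[OF zs(1)]
      by (simp add: relabel_map_strict_mono[OF strict_mono_gap])
    moreover have "\<rho> = inflate n (gap 0) zs"
      using inflate_gap_0[of zs] split m zs length_permutation[OF zs(1)] by (simp add: gap_def)
    moreover have "gap 0 \<in> cuts t m n"
      using t m by (auto intro: gap_in_cuts)
    ultimately show thesis
      using that m zs(1) by metis
  qed
qed

section \<open>Permutations reducing to a given one are its inflations\<close>

lemma inflate_reduces: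
  assumes "\<sigma> \<in> permutations_of_set {0..<k}" "S \<in> cuts t k n" "k \<le> n"
  shows "inflate n S \<sigma> \<in> permutations_of_set {0..<n} \<and> (reduction_step t)\<^sup>*\<^sup>* (inflate n S \<sigma>) \<sigma>"
  using assms(3,2)
proof (induction n arbitrary: S rule: dec_induct)
  case base
  then show ?case
    using cuts_refl[of S t k] assms(1) by (simp add: inflate_id length_permutation)
next
  case (step n)
  \<comment> \<open>One reduction step undoes the outer \<open>gap i\<close>; the induction
    hypothesis covers the inner cut \<open>f\<close>.\<close>
  obtain i f where f: "f \<in> cuts t k n" "gap i \<in> cuts t n (Suc n)" "S = gap i \<circ> f"
    using cuts_factor[OF step.prems step.hyps(1)] .
  note IH = step.IH[OF f(1)]
  have "inflate (Suc n) S \<sigma> = inflate (Suc n) (gap i) (inflate n f \<sigma>)"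
    using inflate_inflate[OF f(1,2)] IH assms(1) f(3) by (simp add: length_permutation)
  then show ?case
    using inflate_gap_reduces[OF _ f(2), of "inflate n f \<sigma>"] IH
    by (auto intro: converse_rtranclp_into_rtranclp)
qed

text \<open>Going backwards from \<open>\<sigma>\<close>, each step contributes one cut, and cuts
  compose.\<close>

lemma reduces_imp_inflate:
  assumes "(reduction_step t)\<^sup>*\<^sup>* \<pi> \<sigma>" "\<sigma> \<in> permutations_of_set {0..<k}"
    "\<pi> \<in> permutations_of_set {0..<n}"
  shows "\<exists>S \<in> cuts t k n. \<pi> = inflate n S \<sigma>"
  using assms(1,3)
proof (induction arbitrary: n rule: converse_rtranclp_induct)
  case base
  then have "n = k"
    using assms(2) length_permutation by metis
  with base show ?case
    using id_in_cuts inflate_id length_permutation by metis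
next
  case (step \<rho> \<pi>)
  obtain m g where g: "n = Suc m" "\<pi> \<in> permutations_of_set {0..<m}" "g \<in> cuts t m n"
    "\<rho> = inflate n g \<pi>"
    using reduction_step_inflate[OF step.hyps(1) step.prems] .
  obtain f where f: "f \<in> cuts t k m" "\<pi> = inflate m f \<sigma>"
    using step.IH[OF g(2)] by auto
  have "\<rho> = inflate n (g \<circ> f) \<sigma>"
    using inflate_inflate[OF f(1) g(3)] g f assms(2) by (metis length_permutation)
  with cuts_comp[OF f(1) g(3)] show ?case
    by blast
qed

section \<open>Recovering the cut from an inflation\<close>

lemma irreducibleD:
  assumes "\<sigma> \<in> perms_with_adj t k 0"
  shows "\<sigma> \<in> permutations_of_set {0..<k}" "\<not> inner_adj \<sigma> i" "\<not> last_adj t \<sigma>" "\<not> first_adj t \<sigma>"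
proof -
  \<comment> \<open>An infinite set would have \<open>card\<close> equal to \<open>0\<close> as
    well.\<close>
  have "finite {i. inner_adj \<sigma> i}"
    by (rule finite_subset[of _ "{..<length \<sigma>}"]) (auto simp: inner_adj_def)
  with assms show "\<sigma> \<in> permutations_of_set {0..<k}" "\<not> inner_adj \<sigma> i" "\<not> last_adj t \<sigma>" "\<not> first_adj t \<sigma>"
    by (auto simp: perms_with_adj_def num_adj_def split: if_splits)
qed

text \<open>At the first difference, \<open>S'\<close> keeps the value \<open>S i\<close> in the
  same interval as \<open>S i - 1\<close> (in the initial interval if \<open>i = 0\<close>). For the
  lists to agree, the interval of \<open>S\<close> starting at \<open>S i\<close> must come next
  there, which forces an adjacency in \<open>\<sigma>\<close>.\<close>

lemma inflate_first_difference:
  assumes \<sigma>: "\<sigma> \<in> perms_with_adj t k 0" and k: "1 \<le> k" "k \<le> n"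
    and S: "S \<in> cuts t k n" and S': "S' \<in> cuts t k n"
    and eq: "inflate n S \<sigma> = inflate n S' \<sigma>" and i: "i \<le> k" "\<And>j. j < i \<Longrightarrow> S j = S' j"
  shows "\<not> S i < S' i"
proof
  assume less: "S i < S' i"
  note irr = irreducibleD[OF \<sigma>]
  note \<sigma>p = permutations_of_setD[OF irr(1)] length_permutation[OF irr(1)]
  have inj: "S j = S i \<longleftrightarrow> j = i" for j
    using S by (auto simp: cuts_def strict_mono_eq)
  \<comment> \<open>Interval starts are distinct, so a tail beginning with \<open>S i\<close> begins
    with the interval of the entry \<open>i\<close>, or with the final interval if
    \<open>i = k\<close>.\<close>
  have head: "(us = [] \<and> i = k) \<or> (\<exists>vs. us = i # vs)"
    if "blow_up S us @ [S k..<n] = S i # zs" for us zs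
  proof (cases us)
    case Nil
    with that have "S k = S i" by (simp add: upt_eq_Cons_conv)
    with Nil inj show ?thesis by auto
  next
    case (Cons v vs)
    have "S v < S (Suc v)"
      using S by (auto simp: cuts_def strict_mono_def)
    with that Cons have "S v = S i" by (simp add: upt_conv_Cons)
    with Cons inj show ?thesis by auto
  qed
  show False
  proof (cases i)
    case 0
    have "[0..<S' 0] = [0..<S 0] @ S 0 # [Suc (S 0)..<S' 0]"
      using less 0 by (metis le0 less_or_eq_imp_le upt_append_upt upt_conv_Cons)
    with eq 0 have "\<exists>zs. blow_up S \<sigma> @ [S k..<n] = S i # zs"
      by (simp add: inflate_def \<sigma>p)
    \<comment> \<open>Here \<open>1 \<le> k\<close> excludes the final interval.\<close>
    then obtain vs where "\<sigma> = 0 # vs"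
      using head 0 k by auto
    moreover have "t \<in> {Type3, Type4}"
      using less 0 S' by (cases t) (auto simp: cuts_def)
    ultimately show False
      using irr(4) by (simp add: first_adj_def)
  next
    case (Suc j)
    then obtain us vs where split: "\<sigma> = us @ j # vs"
      using \<sigma>p(1) i(1) by (metis Suc_le_eq atLeastLessThan_iff le0 split_list)
    have Sj: "S j < S i" "S' j = S j"
      using S Suc i(2)[of j] strict_monoD[of S j i] by (auto simp: cuts_def)
    \<comment> \<open>Under \<open>S\<close> the interval of \<open>j\<close> ends with
      \<open>x\<close>; under \<open>S'\<close> it continues with
      \<open>Suc x = S i\<close>.\<close>
    define x where "x = S i - 1"
    have x: "S j \<le> x" "S i = Suc x"
      using Sj by (auto simp: x_def)
    have "[S j..<S i] = [S j..<x] @ [x]"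
      using x by simp
    moreover have "k = Suc (length us + length vs)"
      using \<sigma>p(3) split by simp
    ultimately have l: "inflate n S \<sigma> = ([0..<S 0] @ blow_up S us @ [S j..<x]) @ x # blow_up S vs @ [S k..<n]"
      by (simp add: inflate_def split Suc[symmetric])
    have "[S' j..<S' i] = [S j..<x] @ x # Suc x # [Suc (Suc x)..<S' i]"
      using x Sj less by (metis Suc_lessD Suc_leI le_SucI less_or_eq_imp_le upt_append_upt upt_conv_Cons)
    then obtain us' vs' where r: "inflate n S' \<sigma> = us' @ x # Suc x # vs'"
      by (simp add: inflate_def split Suc[symmetric]) (metis append.assoc append_Cons)
    have "distinct (inflate n S \<sigma>)"
      using inflate_reduces[OF irr(1) S k(2)] by (auto dest: permutations_of_setD)
    \<comment> \<open>The value \<open>x\<close> occurs only once, so the parts after it in both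
      decompositions agree.\<close>
    with l r eq have "blow_up S vs @ [S k..<n] = S i # vs'"
      unfolding x(2) by (metis append_Cons_eq_iff distinct.simps(2) distinct_append
          not_distinct_conv_prefix)
    from head[OF this] show False
    proof (elim disjE exE conjE)
      assume "vs = []" "i = k"
      \<comment> \<open>From \<open>S k < S' k \<le> n\<close> the value \<open>S k\<close> is not
        \<open>n\<close>, so the type allows a final interval.\<close>
      moreover have "t \<in> {Type2, Type4}"
        using less S S' \<open>i = k\<close> by (cases t) (auto simp: cuts_def)
      ultimately show False
        using irr(3) split \<sigma>p Suc by (simp add: last_adj_def)
    next
      fix ws assume "vs = i # ws"
      then have "inner_adj \<sigma> (length us)"
        using split Suc by (simp add: inner_adj_def nth_append)
      with irr(2) show False by blast
    qed
  qed
qed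

text \<open>At a first difference one of the two cuts would be smaller; both orders are excluded up
  to \<open>k\<close>, and beyond \<open>k\<close> the values are prescribed.\<close>

lemma inj_on_inflate:
  assumes "\<sigma> \<in> perms_with_adj t k 0" "1 \<le> k" "k \<le> n"
  shows "inj_on (\<lambda>S. inflate n S \<sigma>) (cuts t k n)"
proof (rule inj_onI, rule ext)
  fix S S' i
  assume S: "S \<in> cuts t k n" "S' \<in> cuts t k n" and eq: "inflate n S \<sigma> = inflate n S' \<sigma>"
  show "S i = S' i"
  proof (induction i rule: less_induct)
    case (less i)
    show ?case
    proof (cases "i \<le> k")
      case True
      then show ?thesis
        using inflate_first_difference[OF assms S eq, of i]
          inflate_first_difference[OF assms S(2,1) eq[symmetric], of i] less by force
    next
      case False
      then show ?thesis
        using S by (simp add: cuts_def)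
    qed
  qed
qed

text \<open>Inflation maps the cuts bijectively onto the counted permutations, and the set of cuts
  is the same for every \<open>\<sigma>\<close>.\<close>

lemma card_reduced_form:
  assumes "\<sigma> \<in> perms_with_adj t k 0" "1 \<le> k" "k \<le> n"
  shows "card {\<pi> \<in> permutations_of_set {0..<n}. is_reduced_form t \<pi> \<sigma>} = card (cuts t k n)"
proof -
  have "{\<pi> \<in> permutations_of_set {0..<n}. is_reduced_form t \<pi> \<sigma>} = (\<lambda>S. inflate n S \<sigma>) ` cuts t k n"
    using assms irreducibleD(1)[OF assms(1)] reduces_imp_inflate[of t _ \<sigma> k n]
      inflate_reduces[of \<sigma> k _ t n]
    by (fastforce simp: is_reduced_form_def perms_with_adj_def)
  then show ?thesis
    using inj_on_inflate[OF assms] by (simp add: card_image)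
qed

theorem theorem4:
  fixes t :: adj_type and k n :: nat and \<sigma> \<tau> :: "nat list"
  assumes "1 \<le> k" and "k \<le> n"
    and "\<sigma> \<in> perms_with_adj t k 0" and "\<tau> \<in> perms_with_adj t k 0"
  shows "card {\<pi> \<in> permutations_of_set {0..<n}. is_reduced_form t \<pi> \<sigma>}
       = card {\<pi> \<in> permutations_of_set {0..<n}. is_reduced_form t \<pi> \<tau>}"
  using assms by (simp add: card_reduced_form)

end
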